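(* Let $G$ be a $T_1$ topological fan quasigroup. Then its fan $N_0=N_0(G)$ is a normal subgroup of $G$. Moreover, if $N_1$ is a subgroup closed in $G$ with $N_0\subseteq N_1\subseteq N(G)$ and $xN_1=N_1x$ for each $x\in G$, then the quotient $G/_cN_1$ is a $T_1\cap T_{3.5}$ topological group.
   Context: A quasigroup is a set $G$ with a (single-valued) binary operation such that for all $a,b\in G$ there are a unique $x\in G$ with $ax=b$ (denoted $x=a\setminus b=Div_l(a,b)$) and a unique $y\in G$ with $ya=b$ (denoted $y=b/a=Div_r(a,b)$). It is unital if there is $e\in G$ with $eg=ge=g$ for all $g\in G$. A topological quasigroup is a quasigroup with a topology making multiplication, $Div_l$ and $Div_r$ jointly continuous. The nucleus is $N(G)=N_l(G)\cap N_m(G)\cap N_r(G)$, where $N_l(G)=\{a:\forall b,c\in G,\ (ab)c=a(bc)\}$, $N_m(G)=\{a:\forall b,c\in G,\ (ba)c=b(ac)\}$, $N_r(G)=\{a:\forall b,c\in G,\ (bc)a=b(ca)\}$. A fan quasigroup is a unital quasigroup $G$ such that for all $a,b,c\in G$ one has $(ab)c=t(a,b,c)\,a(bc)$ and $(ab)c=a(bc)\,p(a,b,c)$ with $t(a,b,c)\in N(G)$ and $p(a,b,c)\in N(G)$. A topological fan quasigroup is a topological quasigroup that is a fan quasigroup; its fan $N_0(G)$ is the minimal closed subgroup of $G$ containing $t(a,b,c)$ and $p(a,b,c)$ for all $a,b,c\in G$. A subquasigroup $H$ of a quasigroup $G$ is normal if $xH=Hx$, $(xy)H=x(yH)$, $(xH)y=x(Hy)$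 and $H(xy)=(Hx)y$ for all $x,y\in G$. $G/_cH$ denotes the family of cosets $\{bH:b\in G\}$; it is considered with multiplication $(aH)(bH)=(ab)H$ and the quotient topology. $T_1\cap T_{3.5}$ means $T_1$ and completely regular. *)

theory Defs
  imports "HOL-Analysis.Analysis" "HOL-Algebra.Coset"
begin

text \<open>
  Magmas are represented by the \<^type>\<open>monoid_scheme\<close> records of HOL-Algebra; no associativity or
  unit law is implied by the record itself. The cosets \<open>x <# H\<close> and \<open>H #> x\<close> are those of
  HOL-Algebra, whose definitions do not assume a group.
\<close>

locale quasigroup =
  fixes G (structure)
  assumes m_closed [intro, simp]:
      "\<lbrakk>a \<in> carrier G; b \<in> carrier G\<rbrakk> \<Longrightarrow> a \<otimes> b \<in> carrier G"
    and ex1_left: "\<lbrakk>a \<in> carrier G; b \<in> carrier G\<rbrakk> \<Longrightarrow> \<exists>!x. x \<in> carrier G \<and> a \<otimes> x = b"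
    and ex1_right: "\<lbrakk>a \<in> carrier G; b \<in> carrier G\<rbrakk> \<Longrightarrow> \<exists>!y. y \<in> carrier G \<and> y \<otimes> a = b"

text \<open>Both divisions take the divisor first: \<open>Div_l G a b\<close> is $a\backslash b$ and
  \<open>Div_r G a b\<close> is $b/a$.\<close>

definition Div_l :: "('a, 'b) monoid_scheme \<Rightarrow> 'a \<Rightarrow> 'a \<Rightarrow> 'a" where
  "Div_l G a b = (THE x. x \<in> carrier G \<and> a \<otimes>\<^bsub>G\<^esub> x = b)"

definition Div_r :: "('a, 'b) monoid_scheme \<Rightarrow> 'a \<Rightarrow> 'a \<Rightarrow> 'a" where
  "Div_r G a b = (THE y. y \<in> carrier G \<and> y \<otimes>\<^bsub>G\<^esub> a = b)"

context quasigroup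
begin

lemma Div_l:
  assumes "a \<in> carrier G" "b \<in> carrier G"
  shows "Div_l G a b \<in> carrier G" "a \<otimes> Div_l G a b = b"
  using theI'[OF ex1_left[OF assms]] by (simp_all add: Div_l_def)

lemma Div_r:
  assumes "a \<in> carrier G" "b \<in> carrier G"
  shows "Div_r G a b \<in> carrier G" "Div_r G a b \<otimes> a = b"
  using theI'[OF ex1_right[OF assms]] by (simp_all add: Div_r_def)

end

locale unital_quasigroup = quasigroup +
  assumes one_closed [intro, simp]: "\<one> \<in> carrier G"
    and l_one [simp]: "g \<in> carrier G \<Longrightarrow> \<one> \<otimes> g = g"
    and r_one [simp]: "g \<in> carrier G \<Longrightarrow> g \<otimes> \<one> = g"

definition subquasigroup :: "'a set \<Rightarrow> ('a, 'b) monoid_scheme \<Rightarrow> bool" where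
  "subquasigroup H G \<longleftrightarrow> H \<subseteq> carrier G \<and> quasigroup (G\<lparr>carrier := H\<rparr>)"

text \<open>
  A subgroup of a quasigroup is a subset that is a group under the restricted multiplication. The
  predicate \<^const>\<open>subgroup\<close> of HOL-Algebra is not used: it demands closure under a two-sided
  inverse taken in \<open>G\<close>, which need not exist for elements outside of \<open>H\<close>.
\<close>

definition subgroup_in :: "'a set \<Rightarrow> ('a, 'b) monoid_scheme \<Rightarrow> bool" where
  "subgroup_in H G \<longleftrightarrow> H \<subseteq> carrier G \<and> group (G\<lparr>carrier := H\<rparr>)"

definition normal_subquasigroup :: "'a set \<Rightarrow> ('a, 'b) monoid_scheme \<Rightarrow> bool" where
  "normal_subquasigroup H G \<longleftrightarrow> subquasigroup H G \<and>
     (\<forall>x\<in>carrier G. \<forall>y\<in>carrier G.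
        x <#\<^bsub>G\<^esub> H = H #>\<^bsub>G\<^esub> x \<and>
        (x \<otimes>\<^bsub>G\<^esub> y) <#\<^bsub>G\<^esub> H = x <#\<^bsub>G\<^esub> (y <#\<^bsub>G\<^esub> H) \<and>
        (x <#\<^bsub>G\<^esub> H) #>\<^bsub>G\<^esub> y = x <#\<^bsub>G\<^esub> (H #>\<^bsub>G\<^esub> y) \<and>
        H #>\<^bsub>G\<^esub> (x \<otimes>\<^bsub>G\<^esub> y) = (H #>\<^bsub>G\<^esub> x) #>\<^bsub>G\<^esub> y)"

definition left_nucleus :: "('a, 'b) monoid_scheme \<Rightarrow> 'a set" where
  "left_nucleus G = {a \<in> carrier G. \<forall>b\<in>carrier G. \<forall>c\<in>carrier G.
     (a \<otimes>\<^bsub>G\<^esub> b) \<otimes>\<^bsub>G\<^esub> c = a \<otimes>\<^bsub>G\<^esub> (b \<otimes>\<^bsub>G\<^esub> c)}"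

definition middle_nucleus :: "('a, 'b) monoid_scheme \<Rightarrow> 'a set" where
  "middle_nucleus G = {a \<in> carrier G. \<forall>b\<in>carrier G. \<forall>c\<in>carrier G.
     (b \<otimes>\<^bsub>G\<^esub> a) \<otimes>\<^bsub>G\<^esub> c = b \<otimes>\<^bsub>G\<^esub> (a \<otimes>\<^bsub>G\<^esub> c)}"

definition right_nucleus :: "('a, 'b) monoid_scheme \<Rightarrow> 'a set" where
  "right_nucleus G = {a \<in> carrier G. \<forall>b\<in>carrier G. \<forall>c\<in>carrier G.
     (b \<otimes>\<^bsub>G\<^esub> c) \<otimes>\<^bsub>G\<^esub> a = b \<otimes>\<^bsub>G\<^esub> (c \<otimes>\<^bsub>G\<^esub> a)}"

definition nucleus :: "('a, 'b) monoid_scheme \<Rightarrow> 'a set" where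
  "nucleus G = left_nucleus G \<inter> middle_nucleus G \<inter> right_nucleus G"

text \<open>The elements $t(a,b,c)$ and $p(a,b,c)$ with $(ab)c = t(a,b,c)\,(a(bc))$ and
  $(ab)c = (a(bc))\,p(a,b,c)$ exist and are unique in every quasigroup, see \<open>t_assoc\<close> and
  \<open>p_assoc\<close> below. The condition on a fan quasigroup is that they lie in the nucleus.\<close>

definition t_assoc :: "('a, 'b) monoid_scheme \<Rightarrow> 'a \<Rightarrow> 'a \<Rightarrow> 'a \<Rightarrow> 'a" where
  "t_assoc G a b c =
     Div_r G (a \<otimes>\<^bsub>G\<^esub> (b \<otimes>\<^bsub>G\<^esub> c)) ((a \<otimes>\<^bsub>G\<^esub> b) \<otimes>\<^bsub>G\<^esub> c)"

definition p_assoc :: "('a, 'b) monoid_scheme \<Rightarrow> 'a \<Rightarrow> 'a \<Rightarrow> 'a \<Rightarrow> 'a" where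
  "p_assoc G a b c =
     Div_l G (a \<otimes>\<^bsub>G\<^esub> (b \<otimes>\<^bsub>G\<^esub> c)) ((a \<otimes>\<^bsub>G\<^esub> b) \<otimes>\<^bsub>G\<^esub> c)"

lemma (in quasigroup) t_assoc:
  assumes "a \<in> carrier G" "b \<in> carrier G" "c \<in> carrier G"
  shows "(a \<otimes> b) \<otimes> c = t_assoc G a b c \<otimes> (a \<otimes> (b \<otimes> c))"
  using assms by (simp add: t_assoc_def Div_r)

lemma (in quasigroup) p_assoc:
  assumes "a \<in> carrier G" "b \<in> carrier G" "c \<in> carrier G"
  shows "(a \<otimes> b) \<otimes> c = (a \<otimes> (b \<otimes> c)) \<otimes> p_assoc G a b c"
  using assms by (simp add: p_assoc_def Div_l)

locale fan_quasigroup = unital_quasigroup +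
  assumes t_assoc_nucleus:
      "\<lbrakk>a \<in> carrier G; b \<in> carrier G; c \<in> carrier G\<rbrakk> \<Longrightarrow> t_assoc G a b c \<in> nucleus G"
    and p_assoc_nucleus:
      "\<lbrakk>a \<in> carrier G; b \<in> carrier G; c \<in> carrier G\<rbrakk> \<Longrightarrow> p_assoc G a b c \<in> nucleus G"

locale topological_quasigroup = quasigroup G
  for G :: "('a, 'b) monoid_scheme" (structure) and T :: "'a topology" +
  assumes topspace_eq: "topspace T = carrier G"
    and continuous_mult: "continuous_map (prod_topology T T) T (\<lambda>(a, b). a \<otimes> b)"
    and continuous_Div_l: "continuous_map (prod_topology T T) T (\<lambda>(a, b). Div_l G a b)"
    and continuous_Div_r: "continuous_map (prod_topology T T) T (\<lambda>(a, b). Div_r G a b)"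

locale topological_fan_quasigroup = topological_quasigroup + fan_quasigroup

locale topological_group = group G
  for G :: "('a, 'b) monoid_scheme" (structure) and T :: "'a topology" +
  assumes topspace_eq: "topspace T = carrier G"
    and continuous_mult: "continuous_map (prod_topology T T) T (\<lambda>(a, b). a \<otimes> b)"
    and continuous_inv: "continuous_map T T (m_inv G)"

definition fan :: "('a, 'b) monoid_scheme \<Rightarrow> 'a topology \<Rightarrow> 'a set" where
  "fan G T = (\<lambda>H. subgroup_in H G \<and> closedin T H) hull
     (\<Union>a\<in>carrier G. \<Union>b\<in>carrier G. \<Union>c\<in>carrier G. {t_assoc G a b c, p_assoc G a b c})"

text \<open>As soon as the generators lie in some closed subgroup, the hull is itself a closed subgroup,
  hence the least one containing them.\<close>

lemma (in unital_quasigroup) subgroup_in_Inter: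
  assumes ne: "\<F> \<noteq> {}" and sub: "\<And>H. H \<in> \<F> \<Longrightarrow> subgroup_in H G"
  shows "subgroup_in (\<Inter>\<F>) G"
proof -
  have sc: "H \<subseteq> carrier G" if "H \<in> \<F>" for H
    using sub[OF that] by (simp add: subgroup_in_def)
  have gr: "group (G\<lparr>carrier := H\<rparr>)" if "H \<in> \<F>" for H
    using sub[OF that] by (simp add: subgroup_in_def)
  note mon = group.is_monoid[OF gr]
  obtain K where K: "K \<in> \<F>" using ne by blast
  define I where "I = \<Inter>\<F>"
  have I_D: "x \<in> H" if "x \<in> I" "H \<in> \<F>" for x H using that by (simp add: I_def)
  have I_I: "x \<in> I" if "\<And>H. H \<in> \<F> \<Longrightarrow> x \<in> H" for x using that by (simp add: I_def)
  have IG: "I \<subseteq> carrier G" using I_D K sc by blast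
  have mult: "x \<otimes> y \<in> I" if "x \<in> I" "y \<in> I" for x y
  proof (rule I_I)
    fix H assume H: "H \<in> \<F>"
    show "x \<otimes> y \<in> H"
      using monoid.m_closed[OF mon[OF H], of x y] that I_D H by simp
  qed
  have one: "\<one> \<in> I"
  proof (rule I_I)
    fix H assume H: "H \<in> \<F>"
    show "\<one> \<in> H" using monoid.one_closed[OF mon[OF H]] by simp
  qed
  have assoc: "x \<otimes> y \<otimes> z = x \<otimes> (y \<otimes> z)" if "x \<in> I" "y \<in> I" "z \<in> I" for x y z
    using monoid.m_assoc[OF mon[OF K], of x y z] that[THEN I_D, OF K] by simp
  have inv: "\<exists>y\<in>I. y \<otimes> x = \<one>" if x: "x \<in> I" for x
  proof -
    have xG: "x \<in> carrier G" using x IG by blast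
    have ex: "\<exists>y\<in>H. y \<otimes> x = \<one>" if H: "H \<in> \<F>" for H
      using group.l_inv_ex[OF gr[OF H], of x] I_D[OF x H] by simp
    have "Div_r G x \<one> \<in> I"
    proof (rule I_I)
      fix H assume H: "H \<in> \<F>"
      obtain y where y: "y \<in> H" "y \<otimes> x = \<one>" using ex[OF H] by blast
      have "y = Div_r G x \<one>"
        using ex1_right[OF xG one_closed] y sc[OF H] Div_r[OF xG one_closed] by blast
      with y show "Div_r G x \<one> \<in> H" by simp
    qed
    with Div_r(2)[OF xG one_closed] show ?thesis by blast
  qed
  have "group (G\<lparr>carrier := I\<rparr>)"
  proof (rule groupI)
    show "\<one>\<^bsub>G\<lparr>carrier := I\<rparr>\<^esub> \<in> carrier (G\<lparr>carrier := I\<rparr>)" using one by simp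
  next
    fix x assume "x \<in> carrier (G\<lparr>carrier := I\<rparr>)"
    then have x: "x \<in> I" by simp
    then show "\<one>\<^bsub>G\<lparr>carrier := I\<rparr>\<^esub> \<otimes>\<^bsub>G\<lparr>carrier := I\<rparr>\<^esub> x = x"
      using l_one IG by (simp add: subset_iff)
    show "\<exists>y\<in>carrier (G\<lparr>carrier := I\<rparr>). y \<otimes>\<^bsub>G\<lparr>carrier := I\<rparr>\<^esub> x = \<one>\<^bsub>G\<lparr>carrier := I\<rparr>\<^esub>"
      using inv[OF x] by simp
  qed (simp_all add: mult assoc)
  with IG show ?thesis by (simp add: subgroup_in_def I_def)
qed

lemma (in unital_quasigroup) fan_least:
  assumes "subgroup_in K G" "closedin T K"
    and "\<And>a b c. \<lbrakk>a \<in> carrier G; b \<in> carrier G; c \<in> carrier G\<rbrakk> \<Longrightarrow>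
           t_assoc G a b c \<in> K \<and> p_assoc G a b c \<in> K"
  shows "subgroup_in (fan G T) G" "closedin T (fan G T)" "fan G T \<subseteq> K"
    "\<And>a b c. \<lbrakk>a \<in> carrier G; b \<in> carrier G; c \<in> carrier G\<rbrakk> \<Longrightarrow>
           t_assoc G a b c \<in> fan G T \<and> p_assoc G a b c \<in> fan G T"
proof -
  let ?A = "\<Union>a\<in>carrier G. \<Union>b\<in>carrier G. \<Union>c\<in>carrier G. {t_assoc G a b c, p_assoc G a b c}"
  let ?\<F> = "{H. (subgroup_in H G \<and> closedin T H) \<and> ?A \<subseteq> H}"
  have fan: "fan G T = \<Inter>?\<F>" by (simp add: fan_def hull_def)
  have "?A \<subseteq> K"
    by (intro UN_least) (simp add: assms(3))
  then have K: "K \<in> ?\<F>" using assms(1,2) by simp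
  show "subgroup_in (fan G T) G"
    unfolding fan
  proof (rule subgroup_in_Inter)
    show "?\<F> \<noteq> {}" using K by blast
  qed simp
  show "closedin T (fan G T)"
    unfolding fan
  proof (rule closedin_Inter)
    show "?\<F> \<noteq> {}" using K by blast
  qed simp
  show "fan G T \<subseteq> K"
    unfolding fan using K by (rule Inter_lower)
  show "t_assoc G a b c \<in> fan G T \<and> p_assoc G a b c \<in> fan G T"
    if "a \<in> carrier G" "b \<in> carrier G" "c \<in> carrier G" for a b c
    using that unfolding fan by blast
qed

text \<open>Multiplication of cosets by representatives, $(aH)(bH) = (ab)H$. The description is meaningful
  exactly when the product does not depend on the representatives; this has to be proved for each
  \<open>H\<close> in question.\<close>

definition coset_mult ::
  "('a, 'b) monoid_scheme \<Rightarrow> 'a set \<Rightarrow> 'a set \<Rightarrow> 'a set \<Rightarrow> 'a set" where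
  "coset_mult G H A B =
     (THE C. \<exists>a\<in>carrier G. \<exists>b\<in>carrier G.
        A = a <#\<^bsub>G\<^esub> H \<and> B = b <#\<^bsub>G\<^esub> H \<and> C = (a \<otimes>\<^bsub>G\<^esub> b) <#\<^bsub>G\<^esub> H)"

definition coset_quotient :: "('a, 'b) monoid_scheme \<Rightarrow> 'a set \<Rightarrow> 'a set monoid" where
  "coset_quotient G H =
     \<lparr>carrier = (\<lambda>b. b <#\<^bsub>G\<^esub> H) ` carrier G,
      monoid.mult = coset_mult G H,
      one = \<one>\<^bsub>G\<^esub> <#\<^bsub>G\<^esub> H\<rparr>"

definition quotient_topology :: "'a topology \<Rightarrow> ('a \<Rightarrow> 'b) \<Rightarrow> 'b topology" where
  "quotient_topology X f =
     topology (\<lambda>U. U \<subseteq> f ` topspace X \<and> openin X {x \<in> topspace X. f x \<in> U})"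

lemma openin_quotient_topology:
  "openin (quotient_topology X f) U \<longleftrightarrow>
     U \<subseteq> f ` topspace X \<and> openin X {x \<in> topspace X. f x \<in> U}"
proof -
  have "istopology (\<lambda>U. U \<subseteq> f ` topspace X \<and> openin X {x \<in> topspace X. f x \<in> U})"
    unfolding istopology_def
  proof (intro conjI allI impI; (elim conjE)?)
    fix S T
    assume "S \<subseteq> f ` topspace X"
    then show "S \<inter> T \<subseteq> f ` topspace X" by (rule le_infI1)
  next
    fix S T
    assume "openin X {x \<in> topspace X. f x \<in> S}" "openin X {x \<in> topspace X. f x \<in> T}"
    then have "openin X ({x \<in> topspace X. f x \<in> S} \<inter> {x \<in> topspace X. f x \<in> T})"
      by (rule openin_Int)
    also have "\<dots> = {x \<in> topspace X. f x \<in> S \<inter> T}" by blast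
    finally show "openin X {x \<in> topspace X. f x \<in> S \<inter> T}" .
  next
    fix \<K> assume K: "\<forall>K\<in>\<K>. K \<subseteq> f ` topspace X \<and> openin X {x \<in> topspace X. f x \<in> K}"
    then show "\<Union>\<K> \<subseteq> f ` topspace X" by (simp add: Sup_le_iff)
    have "openin X (\<Union>K\<in>\<K>. {x \<in> topspace X. f x \<in> K})"
      by (rule openin_Union) (use K in auto)
    also have "(\<Union>K\<in>\<K>. {x \<in> topspace X. f x \<in> K}) = {x \<in> topspace X. f x \<in> \<Union>\<K>}" by blast
    finally show "openin X {x \<in> topspace X. f x \<in> \<Union>\<K>}" .
  qed
  then show ?thesis
    unfolding quotient_topology_def by (simp only: topology_inverse')
qed

lemma topspace_quotient_topology [simp]:
  "topspace (quotient_topology X f) = f ` topspace X"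
proof
  show "topspace (quotient_topology X f) \<subseteq> f ` topspace X"
    using openin_topspace[of "quotient_topology X f"]
    unfolding openin_quotient_topology by (rule conjunct1)
  have "{x \<in> topspace X. f x \<in> f ` topspace X} = topspace X" by blast
  then have "openin (quotient_topology X f) (f ` topspace X)"
    by (simp add: openin_quotient_topology)
  then show "f ` topspace X \<subseteq> topspace (quotient_topology X f)"
    by (rule openin_subset)
qed

lemma quotient_map_quotient_topology: "quotient_map X (quotient_topology X f) f"
  unfolding quotient_map_def openin_quotient_topology topspace_quotient_topology by simp

definition coset_topology ::
  "('a, 'b) monoid_scheme \<Rightarrow> 'a topology \<Rightarrow> 'a set \<Rightarrow> 'a set topology" where
  "coset_topology G T H = quotient_topology T (\<lambda>b. b <#\<^bsub>G\<^esub> H)"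

end

theory Submission
  imports Defs
begin

text \<open>
  \<^bold>\<open>Normality of the fan.\<close> The nucleus \<open>N\<close> is a subgroup, and in a $T_1$ topological loop it is closed,
  being cut out by equations between continuous maps. As it contains all associators, the fan $N_0$
  is a closed subgroup of \<open>N\<close>. Cosets of a subgroup of the nucleus satisfy all conditions of
  normality by mere rebracketing, except for $xN_0 = N_0x$. To obtain the latter, let $(ab)c = ty = yp$
  with $y = a(bc)$. Running around the pentagon of bracketings of four factors yields
  $x((ab)c) = n(xy)$ with \<open>n\<close> a product of associators and their inverses. As all associators are
  nuclear, this reads $(xt)y = (nx)y$ and also $(xy)p = n(xy)$; hence \<open>t\<close> and \<open>p\<close> can be moved past any
  element of \<open>G\<close> from right to left within $N_0$, and symmetrically from left to right
  (\<open>associators_stable\<close>). The elements of $N_0$ with this property form a closed subgroup, so by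
  minimality they exhaust $N_0$ (\<open>fan_coset_commute\<close>).

  \<^bold>\<open>The quotient.\<close> For $N_1$ as in the theorem, normality and nuclearity make the multiplication
  of cosets independent of the representatives, and it is associative because the associators lie in $N_1$.
  The projection onto the quotient is open (\<open>open_map_l_coset\<close>), so the operations remain continuous;
  points of the quotient are closed because $N_1$ is. Complete regularity holds in every
  topological group (\<open>topological_group.completely_regular\<close>): from symmetric neighbourhoods $V_n$ of
  the unit with $V_{n+1}V_{n+1} \subseteq V_n$ one forms products $W_r$ indexed by dyadic rationals \<open>r\<close>, with
  $V_n W_r \subseteq W_{r + 2^{-n}}$. Then $x \mapsto \inf\{r : x \in W_r\}$ is continuous, vanishes at
  the unit and is at least $1$ off $V_0$.
\<close>

section \<open>Topological groups are completely regular\<close>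

text \<open>
  The neighbourhoods of the unit from which a continuous function is built: each \<open>V (Suc n)\<close> is
  small enough for two of its elements to multiply into \<open>V n\<close>, so \<open>V n\<close> plays the role of a
  displacement of size $2^{-n}$.
\<close>

locale halving_sequence = group G for G (structure) +
  fixes V :: "nat \<Rightarrow> 'a set"
  assumes V_subset: "V n \<subseteq> carrier G"
    and one_in_V: "\<one> \<in> V n"
    and V_inv: "x \<in> V n \<Longrightarrow> inv x \<in> V n"
    and V_mult: "\<lbrakk>x \<in> V (Suc n); y \<in> V (Suc n)\<rbrakk> \<Longrightarrow> x \<otimes> y \<in> V n"
begin

text \<open>
  For $k/2^n < 2$, write $k/2^n = 2^{-n_1} + \dots + 2^{-n_r}$ in binary with
  $n_1 > \dots > n_r \geq 0$; then \<open>dyadic_set n k\<close> is the product $V_{n_1} \cdots V_{n_r}$. From $2$ on it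
  is the whole group. Splitting off the last binary digit of \<open>k\<close> turns this into a recursion, in
  which a set depends on the number $k/2^n$ alone.
\<close>

primrec dyadic_set :: "nat \<Rightarrow> nat \<Rightarrow> 'a set" where
  "dyadic_set 0 k = (if k = 0 then {\<one>} else if k = 1 then V 0 else carrier G)"
| "dyadic_set (Suc n) k =
     (if even k then dyadic_set n (k div 2) else V (Suc n) <#> dyadic_set n (k div 2))"

lemma dyadic_set_subset: "dyadic_set n k \<subseteq> carrier G"
proof (induction n arbitrary: k)
  case 0
  then show ?case using V_subset by auto
next
  case (Suc n)
  then show ?case using V_subset by (auto simp: set_mult_closed)
qed

text \<open>
  Left multiplication by \<open>V n\<close> costs $2^{-n}$. If \<open>k\<close> is even, the digit of weight $2^{-n}$ is free
  and \<open>V n\<close> fills it. If \<open>k\<close> is odd, the two factors from \<open>V n\<close> merge into one factor from the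
  preceding, larger neighbourhood: this is the carry in the addition of binary numbers.
\<close>

lemma dyadic_set_step:
  assumes "x \<in> V n" "y \<in> dyadic_set n k"
  shows "x \<otimes> y \<in> dyadic_set n (Suc k)"
  using assms
proof (induction n arbitrary: k x y)
  case 0
  then show ?case using V_subset[of 0] by (auto split: if_splits)
next
  case (Suc n)
  show ?case
  proof (cases "even k")
    case True
    with Suc.prems show ?thesis by (auto simp: set_mult_def)
  next
    case False
    then obtain z w where zw: "z \<in> V (Suc n)" "w \<in> dyadic_set n (k div 2)" "y = z \<otimes> w"
      using Suc.prems(2) by (auto simp: set_mult_def)
    have "x \<otimes> y = (x \<otimes> z) \<otimes> w"
      using zw Suc.prems(1) V_subset dyadic_set_subset by (auto simp: subset_iff m_assoc)
    also have "\<dots> \<in> dyadic_set n (Suc (k div 2))"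
      by (rule Suc.IH[OF V_mult[OF Suc.prems(1) zw(1)] zw(2)])
    also have "Suc (k div 2) = Suc k div 2" using False by presburger
    finally show ?thesis using False by simp
  qed
qed

lemma dyadic_set_mono:
  assumes "k \<le> l"
  shows "dyadic_set n k \<subseteq> dyadic_set n l"
proof (rule lift_Suc_mono_le[OF _ assms])
  fix k show "dyadic_set n k \<subseteq> dyadic_set n (Suc k)"
  proof
    fix x assume x: "x \<in> dyadic_set n k"
    then have "\<one> \<otimes> x = x" using dyadic_set_subset by (simp add: subset_iff)
    with dyadic_set_step[OF one_in_V x] show "x \<in> dyadic_set n (Suc k)" by simp
  qed
qed

lemma dyadic_set_refine: "dyadic_set (n + m) (2 ^ m * k) = dyadic_set n k"
  by (induction m) (simp_all add: mult.assoc)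

lemma dyadic_set_le:
  assumes "real k / 2 ^ n \<le> real l / 2 ^ m"
  shows "dyadic_set n k \<subseteq> dyadic_set m l"
proof -
  have "real (2 ^ m * k) \<le> real (2 ^ n * l)"
    using assms by (simp add: field_simps)
  then have "2 ^ m * k \<le> 2 ^ n * l" by (simp only: of_nat_le_iff)
  then have "dyadic_set (n + m) (2 ^ m * k) \<subseteq> dyadic_set (n + m) (2 ^ n * l)"
    by (rule dyadic_set_mono)
  then show ?thesis
    using dyadic_set_refine[of n m k] dyadic_set_refine[of m n l] by (simp add: add.commute)
qed

text \<open>
  A function that vanishes at the unit, is at least $1$ outside of \<open>V 0\<close>, and is continuous as
  soon as all \<open>V n\<close> are open.
\<close>

definition dyadic_gauge :: "'a \<Rightarrow> real" where
  "dyadic_gauge x = Inf {real k / 2 ^ n | n k. x \<in> dyadic_set n k}"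

lemma dyadic_gauge_le:
  assumes "x \<in> dyadic_set n k"
  shows "dyadic_gauge x \<le> real k / 2 ^ n"
  unfolding dyadic_gauge_def
  by (rule cInf_lower) (use assms in \<open>auto intro!: bdd_belowI[of _ 0]\<close>)

lemma dyadic_levels_nonempty:
  assumes "x \<in> carrier G"
  shows "{real k / 2 ^ n | n k. x \<in> dyadic_set n k} \<noteq> {}"
proof -
  have "x \<in> dyadic_set 0 2" using assms by simp
  then show ?thesis by blast
qed

lemma dyadic_gauge_ge:
  assumes "x \<in> carrier G" "\<And>n k. x \<in> dyadic_set n k \<Longrightarrow> r \<le> real k / 2 ^ n"
  shows "r \<le> dyadic_gauge x"
  unfolding dyadic_gauge_def
  by (rule cInf_greatest[OF dyadic_levels_nonempty[OF assms(1)]]) (use assms(2) in auto)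

lemma dyadic_gauge_one: "dyadic_gauge \<one> = 0"
  using dyadic_gauge_le[of \<one> 0 0] dyadic_gauge_ge[of \<one> 0] by simp

lemma dyadic_gauge_ge_one:
  assumes "x \<in> carrier G" "x \<notin> V 0"
  shows "1 \<le> dyadic_gauge x"
proof (rule dyadic_gauge_ge[OF assms(1)])
  fix n k assume x: "x \<in> dyadic_set n k"
  show "1 \<le> real k / 2 ^ n"
  proof (rule ccontr)
    assume "\<not> ?thesis"
    then have "dyadic_set n k \<subseteq> dyadic_set 0 1" by (intro dyadic_set_le) simp
    with x assms(2) show False by auto
  qed
qed

text \<open>
  If \<open>x\<close> has level $j/2^m$, then rounding this up to a multiple of $2^{-n}$ costs at most $2^{-n}$,
  and the multiplication by \<open>v\<close> costs another $2^{-n}$; hence the factor $2$.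
\<close>

lemma dyadic_gauge_mult_le:
  assumes "v \<in> V n" "x \<in> carrier G"
  shows "dyadic_gauge (v \<otimes> x) \<le> dyadic_gauge x + 2 / 2 ^ n"
proof -
  have "dyadic_gauge (v \<otimes> x) - 2 / 2 ^ n \<le> dyadic_gauge x"
  proof (rule dyadic_gauge_ge[OF assms(2)])
    fix m j assume x: "x \<in> dyadic_set m j"
    define k where "k = nat \<lceil>real j / 2 ^ m * 2 ^ n\<rceil>"
    have kr: "real k = of_int \<lceil>real j / 2 ^ m * 2 ^ n\<rceil>"
      unfolding k_def by simp
    have "real j / 2 ^ m * 2 ^ n \<le> real k"
      unfolding kr by (rule le_of_int_ceiling)
    then have "real j / 2 ^ m \<le> real k / 2 ^ n" by (simp add: pos_le_divide_eq)
    then have "x \<in> dyadic_set n k" using dyadic_set_le x by blast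
    from dyadic_gauge_le[OF dyadic_set_step[OF assms(1) this]]
    have "dyadic_gauge (v \<otimes> x) \<le> (real k + 1) / 2 ^ n" by (simp add: add.commute)
    also have "real k \<le> real j / 2 ^ m * 2 ^ n + 1"
      unfolding kr by linarith
    then have "(real k + 1) / 2 ^ n \<le> (real j / 2 ^ m * 2 ^ n + 2) / 2 ^ n"
      by (intro divide_right_mono) auto
    also have "\<dots> = real j / 2 ^ m + 2 / 2 ^ n" by (simp add: add_divide_distrib)
    finally show "dyadic_gauge (v \<otimes> x) - 2 / 2 ^ n \<le> real j / 2 ^ m" by simp
  qed
  then show ?thesis by simp
qed

lemma dyadic_gauge_mult_diff_le:
  assumes v: "v \<in> V n" and x: "x \<in> carrier G"
  shows "\<bar>dyadic_gauge (v \<otimes> x) - dyadic_gauge x\<bar> \<le> 2 / 2 ^ n"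
proof -
  have vG: "v \<in> carrier G" using v V_subset by blast
  have "inv v \<otimes> (v \<otimes> x) = x" using vG x by (simp flip: m_assoc)
  with dyadic_gauge_mult_le[OF V_inv[OF v], of "v \<otimes> x"] vG x
  have "dyadic_gauge x \<le> dyadic_gauge (v \<otimes> x) + 2 / 2 ^ n" by simp
  with dyadic_gauge_mult_le[OF v x] show ?thesis by linarith
qed

end

context topological_group
begin

lemma continuous_map_mult:
  assumes "continuous_map X T f" "continuous_map X T g"
  shows "continuous_map X T (\<lambda>x. f x \<otimes> g x)"
  using continuous_map_compose[OF continuous_map_pairedI[OF assms] continuous_mult]
  by (simp add: o_def)

lemma continuous_map_mult_right:
  assumes "a \<in> carrier G"
  shows "continuous_map T T (\<lambda>x. x \<otimes> a)"
  using continuous_map_mult[of T "\<lambda>x. x" "\<lambda>_. a"] assms by (simp add: topspace_eq)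

lemma exists_symmetric_half:
  assumes U: "openin T U" "\<one> \<in> U"
  shows "\<exists>V. openin T V \<and> \<one> \<in> V \<and> (\<forall>x\<in>V. inv x \<in> V) \<and> (\<forall>x\<in>V. \<forall>y\<in>V. x \<otimes> y \<in> U)"
proof -
  let ?P = "{p \<in> topspace (prod_topology T T). (case p of (a, b) \<Rightarrow> a \<otimes> b) \<in> U}"
  have op: "openin (prod_topology T T) ?P"
    by (rule openin_continuous_map_preimage[OF continuous_mult U(1)])
  have mem: "(\<one>, \<one>) \<in> ?P" using U by (simp add: topspace_eq)
  obtain A B where AB: "openin T A" "openin T B" "\<one> \<in> A" "\<one> \<in> B" "A \<times> B \<subseteq> ?P"
    using op[unfolded openin_prod_topology_alt, rule_format, OF mem] by (elim exE conjE)
  define C where "C = A \<inter> B"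
  define V where "V = C \<inter> {x \<in> topspace T. inv x \<in> C}"
  have C: "openin T C" "\<one> \<in> C" using AB by (auto simp: C_def)
  have "openin T V"
    unfolding V_def by (intro openin_Int C openin_continuous_map_preimage[OF continuous_inv])
  moreover have "\<one> \<in> V" using C by (simp add: V_def topspace_eq)
  moreover have "inv x \<in> V" if "x \<in> V" for x
    using that by (auto simp: V_def topspace_eq)
  moreover have "x \<otimes> y \<in> U" if "x \<in> V" "y \<in> V" for x y
  proof -
    have "(x, y) \<in> A \<times> B" using that by (simp add: V_def C_def)
    with AB(5) show ?thesis by auto
  qed
  ultimately show ?thesis by blast
qed

text \<open>
  The unit lies in the symmetric set \<open>V 0\<close>, so choosing \<open>V 0\<close> with products in \<open>U\<close> makes it a subset
  of \<open>U\<close>.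
\<close>

lemma obtain_halving_sequence:
  assumes U: "openin T U" "\<one> \<in> U"
  obtains V where "halving_sequence G V" "\<And>n. openin T (V n)" "V 0 \<subseteq> U"
proof -
  define P where "P = (\<lambda>V. openin T V \<and> \<one> \<in> V \<and> (\<forall>x\<in>V. inv x \<in> V))"
  have half: "\<exists>V. P V \<and> (\<forall>x\<in>V. \<forall>y\<in>V. x \<otimes> y \<in> U)" if "openin T U" "\<one> \<in> U" for U
    using exists_symmetric_half[OF that] by (auto simp: P_def)
  obtain V0 where V0: "P V0" "\<forall>x\<in>V0. \<forall>y\<in>V0. x \<otimes> y \<in> U" using half[OF U] by blast
  \<comment> \<open>The clause for \<open>n = 0\<close> pins the start of the sequence to \<open>V0\<close>, whose products lie in \<open>U\<close>.\<close>
  have "\<exists>V. \<forall>n. (P (V n) \<and> (n = 0 \<longrightarrow> V n = V0)) \<and> (\<forall>x\<in>V (Suc n). \<forall>y\<in>V (Suc n). x \<otimes> y \<in> V n)"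
  proof (rule dependent_nat_choice)
    show "\<exists>W. P W \<and> (0 = (0::nat) \<longrightarrow> W = V0)" using V0 by blast
  next
    fix W and n :: nat assume "P W \<and> (n = 0 \<longrightarrow> W = V0)"
    then show "\<exists>W'. (P W' \<and> (Suc n = 0 \<longrightarrow> W' = V0)) \<and> (\<forall>x\<in>W'. \<forall>y\<in>W'. x \<otimes> y \<in> W)"
      using half[of W] by (auto simp: P_def)
  qed
  then obtain V where V: "\<And>n. P (V n)" "V 0 = V0"
    "\<And>n x y. \<lbrakk>x \<in> V (Suc n); y \<in> V (Suc n)\<rbrakk> \<Longrightarrow> x \<otimes> y \<in> V n"
    by blast
  have sub: "V n \<subseteq> carrier G" for n
    using V(1)[of n] openin_subset[of T "V n"] by (simp add: P_def topspace_eq)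
  show thesis
  proof
    show "halving_sequence G V"
      by unfold_locales (use V sub in \<open>auto simp: P_def\<close>)
    show "openin T (V n)" for n using V(1) by (simp add: P_def)
    show "V 0 \<subseteq> U"
    proof
      fix x assume x: "x \<in> V 0"
      then have "x \<otimes> \<one> \<in> U" using V0 V(2) by (simp add: P_def)
      with x sub show "x \<in> U" by (simp add: subset_iff)
    qed
  qed
qed

lemma continuous_map_dyadic_gauge:
  assumes "halving_sequence G V" and V: "\<And>n. openin T (V n)"
  shows "continuous_map T euclideanreal (halving_sequence.dyadic_gauge G V)"
proof -
  interpret halving_sequence G V by (rule assms(1))
  show ?thesis
    unfolding continuous_map_eq_topcontinuous_at topcontinuous_at_def
  proof (intro ballI conjI allI impI)
    fix x S assume x: "x \<in> topspace T" and S: "openin euclideanreal S \<and> dyadic_gauge x \<in> S"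
    have xG: "x \<in> carrier G" using x by (simp add: topspace_eq)
    obtain e where e: "e > 0" "ball (dyadic_gauge x) e \<subseteq> S"
      using S open_contains_ball by (metis open_openin)
    obtain n where n: "(1/2) ^ n < e / 2"
      using real_arch_pow_inv[of "e / 2" "1/2"] e by auto
    let ?N = "{y \<in> topspace T. y \<otimes> inv x \<in> V n}"
    have "openin T ?N"
      by (rule openin_continuous_map_preimage[OF continuous_map_mult_right V]) (simp add: xG)
    moreover have "x \<in> ?N" using x xG one_in_V by simp
    moreover have "dyadic_gauge y \<in> S" if y: "y \<in> ?N" for y
    proof -
      have yG: "y \<in> carrier G" using y by (simp add: topspace_eq)
      have "(y \<otimes> inv x) \<otimes> x = y" using xG yG by (simp add: m_assoc)
      with dyadic_gauge_mult_diff_le[of "y \<otimes> inv x" n x] y xG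
      have "\<bar>dyadic_gauge y - dyadic_gauge x\<bar> \<le> 2 / 2 ^ n" by simp
      also have "\<dots> < e" using n by (simp add: power_one_over field_simps)
      finally show ?thesis using e(2) by (auto simp: dist_real_def)
    qed
    ultimately show "\<exists>N. openin T N \<and> x \<in> N \<and> (\<forall>y\<in>N. dyadic_gauge y \<in> S)" by blast
  qed auto
qed

text \<open>
  The gauge separates the unit from the complement of a neighbourhood of it; a right translation
  carries this to any point.
\<close>

theorem completely_regular: "completely_regular_space T"
  unfolding completely_regular_space_alt'
proof (intro allI impI)
  fix S x assume S: "openin T S" and xS: "x \<in> S"
  have x: "x \<in> carrier G" using S xS openin_subset topspace_eq by blast
  have "openin T {u \<in> topspace T. u \<otimes> x \<in> S}"
    by (rule openin_continuous_map_preimage[OF continuous_map_mult_right[OF x] S])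
  moreover have "\<one> \<in> {u \<in> topspace T. u \<otimes> x \<in> S}" using x xS by (simp add: topspace_eq)
  ultimately obtain V where hV: "halving_sequence G V" and V: "\<And>n. openin T (V n)"
    and V0: "V 0 \<subseteq> {u \<in> topspace T. u \<otimes> x \<in> S}"
    by (rule obtain_halving_sequence) blast
  interpret halving_sequence G V by (rule hV)
  let ?f = "\<lambda>y. min 1 (dyadic_gauge (y \<otimes> inv x))"
  have "continuous_map T euclideanreal (dyadic_gauge \<circ> (\<lambda>y. y \<otimes> inv x))"
    using x by (intro continuous_map_compose[OF continuous_map_mult_right]
        continuous_map_dyadic_gauge[OF hV V]) simp
  then have "continuous_map T euclideanreal ?f"
    by (intro continuous_map_real_min) (simp_all add: o_def)
  moreover have "?f x = 0" using x by (simp add: dyadic_gauge_one)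
  moreover have "?f y = 1" if y: "y \<in> topspace T - S" for y
  proof -
    have yG: "y \<in> carrier G" using y by (simp add: topspace_eq)
    have "(y \<otimes> inv x) \<otimes> x = y" using x yG by (simp add: m_assoc)
    then have "y \<otimes> inv x \<notin> V 0" using V0 y by auto
    then show ?thesis using dyadic_gauge_ge_one[of "y \<otimes> inv x"] x yG by simp
  qed
  ultimately show "\<exists>f. continuous_map T euclideanreal f \<and> f x = 0 \<and> f ` (topspace T - S) \<subseteq> {1}"
    by (intro exI[of _ ?f]) blast
qed

end

section \<open>The nucleus of a unital quasigroup\<close>

context quasigroup
begin

lemma l_cancel:
  assumes "a \<otimes> x = a \<otimes> y" "a \<in> carrier G" "x \<in> carrier G" "y \<in> carrier G"
  shows "x = y"
  using ex1_left[of a "a \<otimes> x"] assms by (metis m_closed)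

lemma r_cancel:
  assumes "x \<otimes> a = y \<otimes> a" "a \<in> carrier G" "x \<in> carrier G" "y \<in> carrier G"
  shows "x = y"
  using ex1_right[of a "x \<otimes> a"] assms by (metis m_closed)

lemma Div_l_mult: "\<lbrakk>a \<in> carrier G; x \<in> carrier G\<rbrakk> \<Longrightarrow> Div_l G a (a \<otimes> x) = x"
  using Div_l[of a "a \<otimes> x"] l_cancel by blast

lemma Div_r_mult: "\<lbrakk>a \<in> carrier G; x \<in> carrier G\<rbrakk> \<Longrightarrow> Div_r G a (x \<otimes> a) = x"
  using Div_r[of a "x \<otimes> a"] r_cancel by blast

end

lemma nucleus_carrier: "a \<in> nucleus G \<Longrightarrow> a \<in> carrier G"
  by (simp add: nucleus_def left_nucleus_def)

lemma nucleus_assoc: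
  assumes "a \<in> nucleus G" "b \<in> carrier G" "c \<in> carrier G"
  shows "(a \<otimes>\<^bsub>G\<^esub> b) \<otimes>\<^bsub>G\<^esub> c = a \<otimes>\<^bsub>G\<^esub> (b \<otimes>\<^bsub>G\<^esub> c)"
    and "(b \<otimes>\<^bsub>G\<^esub> a) \<otimes>\<^bsub>G\<^esub> c = b \<otimes>\<^bsub>G\<^esub> (a \<otimes>\<^bsub>G\<^esub> c)"
    and "(b \<otimes>\<^bsub>G\<^esub> c) \<otimes>\<^bsub>G\<^esub> a = b \<otimes>\<^bsub>G\<^esub> (c \<otimes>\<^bsub>G\<^esub> a)"
  using assms by (auto simp: nucleus_def left_nucleus_def middle_nucleus_def right_nucleus_def)

lemma nucleusI:
  assumes "a \<in> carrier G"
    and "\<And>b c. \<lbrakk>b \<in> carrier G; c \<in> carrier G\<rbrakk> \<Longrightarrow>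
      (a \<otimes>\<^bsub>G\<^esub> b) \<otimes>\<^bsub>G\<^esub> c = a \<otimes>\<^bsub>G\<^esub> (b \<otimes>\<^bsub>G\<^esub> c)"
    and "\<And>b c. \<lbrakk>b \<in> carrier G; c \<in> carrier G\<rbrakk> \<Longrightarrow>
      (b \<otimes>\<^bsub>G\<^esub> a) \<otimes>\<^bsub>G\<^esub> c = b \<otimes>\<^bsub>G\<^esub> (a \<otimes>\<^bsub>G\<^esub> c)"
    and "\<And>b c. \<lbrakk>b \<in> carrier G; c \<in> carrier G\<rbrakk> \<Longrightarrow>
      (b \<otimes>\<^bsub>G\<^esub> c) \<otimes>\<^bsub>G\<^esub> a = b \<otimes>\<^bsub>G\<^esub> (c \<otimes>\<^bsub>G\<^esub> a)"
  shows "a \<in> nucleus G"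
  using assms by (simp add: nucleus_def left_nucleus_def middle_nucleus_def right_nucleus_def)

context unital_quasigroup
begin

text \<open>
  Inside of the nucleus associativity is automatic.
\<close>

lemma subgroup_inI:
  assumes "H \<subseteq> nucleus G" "\<one> \<in> H"
    and "\<And>x y. \<lbrakk>x \<in> H; y \<in> H\<rbrakk> \<Longrightarrow> x \<otimes> y \<in> H"
    and "\<And>x. x \<in> H \<Longrightarrow> \<exists>y\<in>H. y \<otimes> x = \<one>"
  shows "subgroup_in H G"
proof -
  have HG: "H \<subseteq> carrier G" using assms(1) by (auto intro: nucleus_carrier)
  have "group (G\<lparr>carrier := H\<rparr>)"
  proof (rule groupI)
    fix x y z
    assume "x \<in> carrier (G\<lparr>carrier := H\<rparr>)" "y \<in> carrier (G\<lparr>carrier := H\<rparr>)"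
      "z \<in> carrier (G\<lparr>carrier := H\<rparr>)"
    then show "x \<otimes>\<^bsub>G\<lparr>carrier := H\<rparr>\<^esub> y \<otimes>\<^bsub>G\<lparr>carrier := H\<rparr>\<^esub> z =
        x \<otimes>\<^bsub>G\<lparr>carrier := H\<rparr>\<^esub> (y \<otimes>\<^bsub>G\<lparr>carrier := H\<rparr>\<^esub> z)"
      using assms(1) HG by (auto intro!: nucleus_assoc(1))
  qed (use assms HG in auto)
  with HG show ?thesis by (simp add: subgroup_in_def)
qed

text \<open>
  Since \<open>a\<close> associates with everything, translating by the left inverse \<open>a'\<close> undoes translating by \<open>a\<close>,
  on either side. Multiplying an associativity law for \<open>a'\<close> by \<open>a\<close> on the appropriate side reduces
  it to one for \<open>a\<close>; for the middle position the factor \<open>a\<close> is split off from \<open>c\<close> instead.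
\<close>

lemma nucleus_inverse:
  assumes a: "a \<in> nucleus G"
  shows "Div_r G a \<one> \<in> nucleus G"
proof -
  have aG: "a \<in> carrier G" using a by (rule nucleus_carrier)
  define a' where "a' = Div_r G a \<one>"
  have a': "a' \<in> carrier G" "a' \<otimes> a = \<one>" using Div_r[OF aG one_closed] by (simp_all add: a'_def)
  have "(a \<otimes> a') \<otimes> a = \<one> \<otimes> a"
    using nucleus_assoc(1)[OF a a'(1) aG] a' aG by simp
  then have aa': "a \<otimes> a' = \<one>" by (rule r_cancel) (use aG a' in auto)
  have l: "a \<otimes> (a' \<otimes> b) = b" if "b \<in> carrier G" for b
    using nucleus_assoc(1)[OF a a'(1) that] aa' that by simp
  have r: "(b \<otimes> a') \<otimes> a = b" if "b \<in> carrier G" for b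
    using nucleus_assoc(3)[OF a that a'(1)] a' that by simp
  have l': "a' \<otimes> (a \<otimes> b) = b" if "b \<in> carrier G" for b
    using nucleus_assoc(2)[OF a a'(1) that] a' that by simp
  have "a' \<in> nucleus G"
  proof (rule nucleusI)
    fix b c assume bc: "b \<in> carrier G" "c \<in> carrier G"
    have "a \<otimes> ((a' \<otimes> b) \<otimes> c) = (a \<otimes> (a' \<otimes> b)) \<otimes> c"
      using bc a' by (intro nucleus_assoc(1)[OF a, symmetric]) auto
    also have "\<dots> = a \<otimes> (a' \<otimes> (b \<otimes> c))" using bc by (simp only: l m_closed)
    finally show "(a' \<otimes> b) \<otimes> c = a' \<otimes> (b \<otimes> c)"
      by (rule l_cancel) (use bc aG a' in auto)
    have "((b \<otimes> c) \<otimes> a') \<otimes> a = b \<otimes> ((c \<otimes> a') \<otimes> a)" using bc by (simp only: r m_closed)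
    also have "\<dots> = (b \<otimes> (c \<otimes> a')) \<otimes> a"
      using bc a' by (intro nucleus_assoc(3)[OF a, symmetric]) auto
    finally show "(b \<otimes> c) \<otimes> a' = b \<otimes> (c \<otimes> a')"
      by (rule r_cancel) (use bc aG a' in auto)
    define d where "d = Div_l G a c"
    have d: "d \<in> carrier G" "a \<otimes> d = c" using Div_l[OF aG bc(2)] by (simp_all add: d_def)
    have "(b \<otimes> a') \<otimes> (a \<otimes> d) = ((b \<otimes> a') \<otimes> a) \<otimes> d"
      using nucleus_assoc(2)[OF a, of "b \<otimes> a'" d] bc a' d by simp
    also have "\<dots> = b \<otimes> (a' \<otimes> (a \<otimes> d))" using bc d(1) by (simp only: r l')
    finally show "(b \<otimes> a') \<otimes> c = b \<otimes> (a' \<otimes> c)" by (simp add: d(2))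
  qed (rule a'(1))
  then show ?thesis by (simp add: a'_def)
qed

lemma nucleus_subgroup: "subgroup_in (nucleus G) G"
proof (rule subgroup_inI)
  show "\<one> \<in> nucleus G" by (rule nucleusI) auto
  show "\<exists>y\<in>nucleus G. y \<otimes> x = \<one>" if "x \<in> nucleus G" for x
    using nucleus_inverse[OF that] Div_r(2)[OF nucleus_carrier[OF that] one_closed] by blast
  fix x y assume xy: "x \<in> nucleus G" "y \<in> nucleus G"
  have G: "x \<in> carrier G" "y \<in> carrier G" using xy by (auto intro: nucleus_carrier)
  show "x \<otimes> y \<in> nucleus G"
  proof (rule nucleusI)
    fix b c assume bc: "b \<in> carrier G" "c \<in> carrier G"
    show "((x \<otimes> y) \<otimes> b) \<otimes> c = (x \<otimes> y) \<otimes> (b \<otimes> c)"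
      using xy G bc by (simp add: nucleus_assoc(1))
    show "(b \<otimes> (x \<otimes> y)) \<otimes> c = b \<otimes> ((x \<otimes> y) \<otimes> c)"
      using nucleus_assoc(2)[OF xy(1), of b y] nucleus_assoc(2)[OF xy(2), of "b \<otimes> x" c]
        nucleus_assoc(2)[OF xy(1), of b "y \<otimes> c"] nucleus_assoc(1)[OF xy(1), of y c] G bc by simp
    show "(b \<otimes> c) \<otimes> (x \<otimes> y) = b \<otimes> (c \<otimes> (x \<otimes> y))"
      using nucleus_assoc(3)[OF xy(2), of "b \<otimes> c" x] nucleus_assoc(3)[OF xy(1), of b c]
        nucleus_assoc(3)[OF xy(2), of b "c \<otimes> x"] nucleus_assoc(3)[OF xy(2), of c x] G bc by simp
  qed (use G in simp)
qed simp

end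

section \<open>Subgroups of the nucleus\<close>

locale nuclear_subgroup = unital_quasigroup G for G (structure) +
  fixes H :: "'a set"
  assumes is_subgroup: "subgroup_in H G"
    and H_nuclear: "H \<subseteq> nucleus G"
begin

lemma H_group: "group (G\<lparr>carrier := H\<rparr>)"
  using is_subgroup by (simp add: subgroup_in_def)

lemma H_carrier [intro, simp]: "h \<in> H \<Longrightarrow> h \<in> carrier G"
  using is_subgroup by (auto simp: subgroup_in_def)

lemma H_one [intro, simp]: "\<one> \<in> H"
  using monoid.one_closed[OF group.is_monoid[OF H_group]] by simp

lemma H_mult [intro, simp]: "\<lbrakk>h \<in> H; k \<in> H\<rbrakk> \<Longrightarrow> h \<otimes> k \<in> H"
  using monoid.m_closed[OF group.is_monoid[OF H_group], of h k] by simp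

lemma H_inverse:
  assumes "h \<in> H"
  obtains k where "k \<in> H" "h \<otimes> k = \<one>" "k \<otimes> h = \<one>"
  using group.l_inv_ex[OF H_group, of h] group.r_inv_ex[OF H_group, of h] assms
    group.inv_comm[OF H_group, of _ h] by auto

lemma H_assoc:
  assumes "h \<in> H" "b \<in> carrier G" "c \<in> carrier G"
  shows "(h \<otimes> b) \<otimes> c = h \<otimes> (b \<otimes> c)" "(b \<otimes> h) \<otimes> c = b \<otimes> (h \<otimes> c)"
    "(b \<otimes> c) \<otimes> h = b \<otimes> (c \<otimes> h)"
  using nucleus_assoc[of h G b c] assms H_nuclear by auto

lemma l_coset_iff: "y \<in> x <# H \<longleftrightarrow> (\<exists>h\<in>H. y = x \<otimes> h)"
  by (auto simp: l_coset_def)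

lemma r_coset_iff: "y \<in> H #> x \<longleftrightarrow> (\<exists>h\<in>H. y = h \<otimes> x)"
  by (auto simp: r_coset_def)

lemma normal_subquasigroupI:
  assumes "\<And>x. x \<in> carrier G \<Longrightarrow> x <# H = H #> x"
  shows "normal_subquasigroup H G"
  unfolding normal_subquasigroup_def
proof (intro conjI ballI)
  have l: "\<exists>!x. x \<in> H \<and> a \<otimes> x = b" if ab: "a \<in> H" "b \<in> H" for a b
  proof -
    obtain k where k: "k \<in> H" "a \<otimes> k = \<one>" by (rule H_inverse[OF ab(1)])
    have "a \<otimes> (k \<otimes> b) = b" using H_assoc(1)[of a k b] k ab by simp
    then show ?thesis using l_cancel[of a] k ab by (intro ex1I[of _ "k \<otimes> b"]) auto
  qed
  have r: "\<exists>!y. y \<in> H \<and> y \<otimes> a = b" if ab: "a \<in> H" "b \<in> H" for a b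
  proof -
    obtain k where k: "k \<in> H" "k \<otimes> a = \<one>" by (rule H_inverse[OF ab(1)])
    have "(b \<otimes> k) \<otimes> a = b" using H_assoc(1)[of b k a] k ab by simp
    then show ?thesis using r_cancel[of _ a] k ab by (intro ex1I[of _ "b \<otimes> k"]) auto
  qed
  show "subquasigroup H G"
    unfolding subquasigroup_def by (intro conjI quasigroup.intro subsetI) (simp_all add: l r)
next
  fix x y assume xy: "x \<in> carrier G" "y \<in> carrier G"
  show "x <# H = H #> x" by (rule assms[OF xy(1)])
  show "(x \<otimes> y) <# H = x <# (y <# H)"
    using xy by (auto simp: l_coset_def H_assoc)
  show "(x <# H) #> y = x <# (H #> y)"
    using xy by (auto simp: l_coset_def r_coset_def H_assoc)
  show "H #> (x \<otimes> y) = (H #> x) #> y"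
    using xy by (auto simp: r_coset_def H_assoc)
qed

end

section \<open>Moving associators past an element\<close>

text \<open>
  Modulo \<open>H\<close> the multiplication is associative. Both the fan and the larger subgroup by which the
  quotient is taken are of this kind.
\<close>

locale associator_subgroup = nuclear_subgroup +
  assumes t_assoc_mem: "\<lbrakk>a \<in> carrier G; b \<in> carrier G; c \<in> carrier G\<rbrakk> \<Longrightarrow> t_assoc G a b c \<in> H"
    and p_assoc_mem: "\<lbrakk>a \<in> carrier G; b \<in> carrier G; c \<in> carrier G\<rbrakk> \<Longrightarrow> p_assoc G a b c \<in> H"
begin

text \<open>
  The two ways around Mac Lane's pentagon from $((xa)b)c$ to $x(a(bc))$. All associators are
  written on the left, where they can be collected because they lie in the nucleus. The result
  compares the product of \<open>x\<close> with the two bracketings of $abc$: it is this comparison which shows how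
  an associator of \<open>a\<close>, \<open>b\<close>, \<open>c\<close> moves past \<open>x\<close>.
\<close>

lemma left_pentagon:
  assumes G: "x \<in> carrier G" "a \<in> carrier G" "b \<in> carrier G" "c \<in> carrier G"
  obtains n where "n \<in> H" "x \<otimes> ((a \<otimes> b) \<otimes> c) = n \<otimes> (x \<otimes> (a \<otimes> (b \<otimes> c)))"
proof -
  define r where "r = t_assoc G x a b \<otimes> t_assoc G x (a \<otimes> b) c"
  define s where "s = t_assoc G (x \<otimes> a) b c \<otimes> t_assoc G x a (b \<otimes> c)"
  have rs: "r \<in> H" "s \<in> H" using G by (simp_all add: r_def s_def t_assoc_mem)
  have "((x \<otimes> a) \<otimes> b) \<otimes> c = (t_assoc G x a b \<otimes> (x \<otimes> (a \<otimes> b))) \<otimes> c"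
    using t_assoc[of x a b] G by simp
  also have "\<dots> = t_assoc G x a b \<otimes> ((x \<otimes> (a \<otimes> b)) \<otimes> c)"
    using G by (simp add: H_assoc t_assoc_mem)
  also have "\<dots> = r \<otimes> (x \<otimes> ((a \<otimes> b) \<otimes> c))"
    using t_assoc[of x "a \<otimes> b" c] G by (simp add: r_def H_assoc t_assoc_mem)
  finally have 1: "((x \<otimes> a) \<otimes> b) \<otimes> c = r \<otimes> (x \<otimes> ((a \<otimes> b) \<otimes> c))" .
  have "((x \<otimes> a) \<otimes> b) \<otimes> c = t_assoc G (x \<otimes> a) b c \<otimes> ((x \<otimes> a) \<otimes> (b \<otimes> c))"
    using t_assoc[of "x \<otimes> a" b c] G by simp
  also have "\<dots> = s \<otimes> (x \<otimes> (a \<otimes> (b \<otimes> c)))"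
    using t_assoc[of x a "b \<otimes> c"] G by (simp add: s_def H_assoc t_assoc_mem)
  finally have 2: "r \<otimes> (x \<otimes> ((a \<otimes> b) \<otimes> c)) = s \<otimes> (x \<otimes> (a \<otimes> (b \<otimes> c)))"
    by (simp add: 1)
  obtain k where k: "k \<in> H" "k \<otimes> r = \<one>" by (rule H_inverse[OF rs(1)])
  have "x \<otimes> ((a \<otimes> b) \<otimes> c) = k \<otimes> (r \<otimes> (x \<otimes> ((a \<otimes> b) \<otimes> c)))"
    using H_assoc(1)[OF k(1), of r "x \<otimes> ((a \<otimes> b) \<otimes> c)"] k rs G by simp
  also have "\<dots> = (k \<otimes> s) \<otimes> (x \<otimes> (a \<otimes> (b \<otimes> c)))"
    unfolding 2 using k rs G by (simp add: H_assoc)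
  finally show thesis using that[of "k \<otimes> s"] k rs by simp
qed

text \<open>
  The mirror image, with the associators collected on the right.
\<close>

lemma right_pentagon:
  assumes G: "x \<in> carrier G" "a \<in> carrier G" "b \<in> carrier G" "c \<in> carrier G"
  obtains m where "m \<in> H" "((a \<otimes> b) \<otimes> c) \<otimes> x = ((a \<otimes> (b \<otimes> c)) \<otimes> x) \<otimes> m"
proof -
  define z where "z = a \<otimes> (b \<otimes> (c \<otimes> x))"
  define r where "r = p_assoc G a b (c \<otimes> x) \<otimes> p_assoc G (a \<otimes> b) c x"
  define s where "s = p_assoc G b c x \<otimes> p_assoc G a (b \<otimes> c) x"
  have rs: "r \<in> H" "s \<in> H" using G by (simp_all add: r_def s_def p_assoc_mem)
  have zG: "z \<in> carrier G" using G by (simp add: z_def)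
  have "((a \<otimes> b) \<otimes> c) \<otimes> x = ((a \<otimes> b) \<otimes> (c \<otimes> x)) \<otimes> p_assoc G (a \<otimes> b) c x"
    using p_assoc[of "a \<otimes> b" c x] G by simp
  also have "\<dots> = z \<otimes> r"
    using p_assoc[of a b "c \<otimes> x"] G by (simp add: z_def r_def H_assoc p_assoc_mem)
  finally have 1: "((a \<otimes> b) \<otimes> c) \<otimes> x = z \<otimes> r" .
  have "(a \<otimes> (b \<otimes> c)) \<otimes> x = (a \<otimes> ((b \<otimes> c) \<otimes> x)) \<otimes> p_assoc G a (b \<otimes> c) x"
    using p_assoc[of a "b \<otimes> c" x] G by simp
  also have "\<dots> = (a \<otimes> ((b \<otimes> (c \<otimes> x)) \<otimes> p_assoc G b c x)) \<otimes> p_assoc G a (b \<otimes> c) x"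
    using p_assoc[of b c x] G by simp
  also have "\<dots> = z \<otimes> s"
    using G H_assoc(3)[of "p_assoc G b c x" a "b \<otimes> (c \<otimes> x)"]
      H_assoc(3)[of "p_assoc G a (b \<otimes> c) x" z "p_assoc G b c x"]
    by (simp add: z_def s_def p_assoc_mem)
  finally have 2: "(a \<otimes> (b \<otimes> c)) \<otimes> x = z \<otimes> s" .
  obtain k where k: "k \<in> H" "s \<otimes> k = \<one>" by (rule H_inverse[OF rs(2)])
  have "s \<otimes> (k \<otimes> r) = r" using H_assoc(1)[OF rs(2), of k r] k rs by simp
  then have "(z \<otimes> s) \<otimes> (k \<otimes> r) = z \<otimes> r" using zG k rs by (simp add: H_assoc(2))
  then show thesis using that[of "k \<otimes> r"] k rs by (simp add: 1 2)
qed

text \<open>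
  The elements that can be moved past every \<open>x\<close>, in both directions, at the price of replacing them
  by another element of \<open>H\<close>. A least subgroup \<open>H\<close> is shown to be invariant under conjugation by
  proving that this part of it is again a competitor.
\<close>

definition stable_part :: "'a set" where
  "stable_part = {a \<in> H. \<forall>x\<in>carrier G. (\<exists>n\<in>H. x \<otimes> a = n \<otimes> x) \<and> (\<exists>m\<in>H. a \<otimes> x = x \<otimes> m)}"

text \<open>
  Let $y = a(bc)$, so that $(ab)c = ty = yp$. Multiplying by \<open>x\<close> from the left, the pentagon gives
  $(xt)y = x(ty) = n(xy) = (nx)y$, so $xt = nx$ with $n \in H$; and $(xy)p = x(yp) = n(xy)$, where
  $xy$ is an arbitrary element of the quasigroup. Thus both kinds of associators move past every
  element to the left. The mirror image settles the other direction, with the roles of \<open>t\<close> and \<open>p\<close>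
  exchanged.
\<close>

lemma associators_stable:
  assumes G: "a \<in> carrier G" "b \<in> carrier G" "c \<in> carrier G"
  shows "t_assoc G a b c \<in> stable_part" "p_assoc G a b c \<in> stable_part"
proof -
  define y where "y = a \<otimes> (b \<otimes> c)"
  define t where "t = t_assoc G a b c"
  define p where "p = p_assoc G a b c"
  have y: "y \<in> carrier G" using G by (simp add: y_def)
  have tp: "t \<in> H" "p \<in> H" using G by (simp_all add: t_def p_def t_assoc_mem p_assoc_mem)
  have ty: "(a \<otimes> b) \<otimes> c = t \<otimes> y" using t_assoc[OF G] by (simp add: t_def y_def)
  have yp: "(a \<otimes> b) \<otimes> c = y \<otimes> p" using p_assoc[OF G] by (simp add: p_def y_def)
  have t_left: "\<exists>n\<in>H. x \<otimes> t = n \<otimes> x" if x: "x \<in> carrier G" for x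
  proof -
    obtain n where n: "n \<in> H" "x \<otimes> ((a \<otimes> b) \<otimes> c) = n \<otimes> (x \<otimes> y)"
      unfolding y_def using left_pentagon[OF x G] by metis
    then have "(x \<otimes> t) \<otimes> y = (n \<otimes> x) \<otimes> y"
      using x y tp n(1) by (simp add: ty H_assoc)
    then have "x \<otimes> t = n \<otimes> x" by (rule r_cancel) (use x y tp n(1) in auto)
    with n(1) show ?thesis by blast
  qed
  have p_right: "\<exists>m\<in>H. p \<otimes> x = x \<otimes> m" if x: "x \<in> carrier G" for x
  proof -
    obtain m where m: "m \<in> H" "((a \<otimes> b) \<otimes> c) \<otimes> x = (y \<otimes> x) \<otimes> m"
      unfolding y_def using right_pentagon[OF x G] by metis
    then have "y \<otimes> (p \<otimes> x) = y \<otimes> (x \<otimes> m)"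
      using x y tp m(1) H_assoc(2)[OF tp(2), of y x] H_assoc(3)[OF m(1), of y x] by (simp add: yp)
    then have "p \<otimes> x = x \<otimes> m" by (rule l_cancel) (use x y tp m(1) in auto)
    with m(1) show ?thesis by blast
  qed
  have p_left: "\<exists>n\<in>H. z \<otimes> p = n \<otimes> z" if z: "z \<in> carrier G" for z
  proof -
    \<comment> \<open>Every \<open>z\<close> has the form \<open>x \<otimes> y\<close>, which is where the comparison by \<open>n\<close> takes place.\<close>
    define x where "x = Div_r G y z"
    have x: "x \<in> carrier G" "x \<otimes> y = z" using Div_r[OF y z] by (simp_all add: x_def)
    obtain n where n: "n \<in> H" "x \<otimes> ((a \<otimes> b) \<otimes> c) = n \<otimes> (x \<otimes> y)"
      unfolding y_def using left_pentagon[OF x(1) G] by metis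
    then have "z \<otimes> p = n \<otimes> z"
      using H_assoc(3)[OF tp(2) x(1) y] x by (simp add: yp)
    with n(1) show ?thesis by blast
  qed
  have t_right: "\<exists>m\<in>H. t \<otimes> z = z \<otimes> m" if z: "z \<in> carrier G" for z
  proof -
    define x where "x = Div_l G y z"
    have x: "x \<in> carrier G" "y \<otimes> x = z" using Div_l[OF y z] by (simp_all add: x_def)
    obtain m where m: "m \<in> H" "((a \<otimes> b) \<otimes> c) \<otimes> x = (y \<otimes> x) \<otimes> m"
      unfolding y_def using right_pentagon[OF x(1) G] by metis
    then have "t \<otimes> z = z \<otimes> m"
      using H_assoc(1)[OF tp(1) y x(1)] x by (simp add: ty)
    with m(1) show ?thesis by blast
  qed
  show "t_assoc G a b c \<in> stable_part" "p_assoc G a b c \<in> stable_part"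
    using tp t_left t_right p_left p_right by (simp_all add: stable_part_def flip: t_def p_def)
qed

lemma stable_part_subgroup: "subgroup_in stable_part G"
proof (rule subgroup_inI)
  show "stable_part \<subseteq> nucleus G" using H_nuclear by (auto simp: stable_part_def)
  show "\<one> \<in> stable_part" by (auto simp: stable_part_def intro!: bexI[of _ \<one>])
next
  fix a b assume ab: "a \<in> stable_part" "b \<in> stable_part"
  then have H: "a \<in> H" "b \<in> H" by (auto simp: stable_part_def)
  show "a \<otimes> b \<in> stable_part"
    unfolding stable_part_def
  proof (intro CollectI conjI ballI)
    fix x assume x: "x \<in> carrier G"
    obtain n where n: "n \<in> H" "x \<otimes> a = n \<otimes> x" using ab(1) x by (auto simp: stable_part_def)
    obtain n' where n': "n' \<in> H" "x \<otimes> b = n' \<otimes> x" using ab(2) x by (auto simp: stable_part_def)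
    have "x \<otimes> (a \<otimes> b) = (x \<otimes> a) \<otimes> b" using H x by (simp add: H_assoc(2))
    also have "\<dots> = n \<otimes> (x \<otimes> b)" using n H x by (simp add: H_assoc(1))
    also have "\<dots> = (n \<otimes> n') \<otimes> x" using n n' x by (simp add: H_assoc(1))
    finally show "\<exists>n\<in>H. x \<otimes> (a \<otimes> b) = n \<otimes> x" using n(1) n'(1) by blast
    obtain m where m: "m \<in> H" "a \<otimes> x = x \<otimes> m" using ab(1) x by (auto simp: stable_part_def)
    obtain m' where m': "m' \<in> H" "b \<otimes> x = x \<otimes> m'" using ab(2) x by (auto simp: stable_part_def)
    have "(a \<otimes> b) \<otimes> x = a \<otimes> (x \<otimes> m')" using H x m' by (simp add: H_assoc(1))
    also have "\<dots> = (x \<otimes> m) \<otimes> m'" using m m' H x by (simp flip: H_assoc(1))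
    also have "\<dots> = x \<otimes> (m \<otimes> m')" using m m' x by (simp add: H_assoc(2))
    finally show "\<exists>m\<in>H. (a \<otimes> b) \<otimes> x = x \<otimes> m" using m(1) m'(1) by blast
  qed (use H in simp)
next
  fix a assume a: "a \<in> stable_part"
  then have aH: "a \<in> H" by (auto simp: stable_part_def)
  obtain k where k: "k \<in> H" "a \<otimes> k = \<one>" "k \<otimes> a = \<one>" by (rule H_inverse[OF aH])
  have "k \<in> stable_part"
    unfolding stable_part_def
  proof (intro CollectI conjI ballI)
    fix x assume x: "x \<in> carrier G"
    obtain n where n: "n \<in> H" "x \<otimes> a = n \<otimes> x" using a x by (auto simp: stable_part_def)
    obtain l where l: "l \<in> H" "l \<otimes> n = \<one>" by (rule H_inverse[OF n(1)])
    have "x = (x \<otimes> a) \<otimes> k" using aH k x by (simp add: H_assoc(2))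
    also have "\<dots> = n \<otimes> (x \<otimes> k)" using n k x by (simp add: H_assoc(1))
    finally have "l \<otimes> x = l \<otimes> (n \<otimes> (x \<otimes> k))" by simp
    also have "\<dots> = x \<otimes> k" using l n(1) k x H_assoc(1)[of l n "x \<otimes> k"] by simp
    finally show "\<exists>n\<in>H. x \<otimes> k = n \<otimes> x" using l(1) by metis
    obtain m where m: "m \<in> H" "a \<otimes> x = x \<otimes> m" using a x by (auto simp: stable_part_def)
    obtain q where q: "q \<in> H" "m \<otimes> q = \<one>" by (rule H_inverse[OF m(1)])
    have "x = k \<otimes> (a \<otimes> x)" using aH k x by (simp flip: H_assoc(1))
    also have "\<dots> = (k \<otimes> x) \<otimes> m" using m k x by (simp add: H_assoc(1))
    finally have "x \<otimes> q = ((k \<otimes> x) \<otimes> m) \<otimes> q" by simp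
    also have "\<dots> = k \<otimes> x" using q m(1) k x by (simp add: H_assoc(2))
    finally show "\<exists>m\<in>H. k \<otimes> x = x \<otimes> m" using q(1) by metis
  qed (rule k(1))
  with k(3) show "\<exists>y\<in>stable_part. y \<otimes> a = \<one>" by blast
qed

lemma coset_commute_of_stable:
  assumes "H \<subseteq> stable_part" and "x \<in> carrier G"
  shows "x <# H = H #> x"
proof (rule Set.set_eqI)
  fix y
  show "y \<in> x <# H \<longleftrightarrow> y \<in> H #> x"
    unfolding l_coset_iff r_coset_iff
  proof
    assume "\<exists>h\<in>H. y = x \<otimes> h"
    then obtain h where "h \<in> stable_part" "y = x \<otimes> h" using assms(1) by blast
    with assms(2) show "\<exists>h\<in>H. y = h \<otimes> x" by (simp add: stable_part_def)
  next
    assume "\<exists>h\<in>H. y = h \<otimes> x"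
    then obtain h where "h \<in> stable_part" "y = h \<otimes> x" using assms(1) by blast
    with assms(2) show "\<exists>h\<in>H. y = x \<otimes> h" by (simp add: stable_part_def)
  qed
qed

text \<open>
  Expressed by divisions, membership becomes a condition that a continuous function takes a value in
  \<open>H\<close>, hence a closed condition.
\<close>

lemma stable_part_Div:
  "stable_part = {a \<in> H. \<forall>x\<in>carrier G. Div_r G x (x \<otimes> a) \<in> H \<and> Div_l G x (a \<otimes> x) \<in> H}"
proof -
  have "(\<exists>n\<in>H. x \<otimes> a = n \<otimes> x) \<longleftrightarrow> Div_r G x (x \<otimes> a) \<in> H" if "a \<in> H" "x \<in> carrier G" for a x
    using that Div_r[of x "x \<otimes> a"] by (metis Div_r_mult H_carrier m_closed)
  moreover have "(\<exists>m\<in>H. a \<otimes> x = x \<otimes> m) \<longleftrightarrow> Div_l G x (a \<otimes> x) \<in> H" if "a \<in> H" "x \<in> carrier G" for a x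
    using that Div_l[of x "a \<otimes> x"] by (metis Div_l_mult H_carrier m_closed)
  ultimately show ?thesis unfolding stable_part_def by blast
qed

end

section \<open>The fan is normal\<close>

locale topological_unital_quasigroup = topological_quasigroup + unital_quasigroup
begin

lemma continuous_map_mult:
  assumes "continuous_map X T f" "continuous_map X T g"
  shows "continuous_map X T (\<lambda>x. f x \<otimes> g x)"
  using continuous_map_compose[OF continuous_map_pairedI[OF assms] continuous_mult]
  by (simp add: o_def)

lemma continuous_map_Div_l:
  assumes "continuous_map X T f" "continuous_map X T g"
  shows "continuous_map X T (\<lambda>x. Div_l G (f x) (g x))"
  using continuous_map_compose[OF continuous_map_pairedI[OF assms] continuous_Div_l]
  by (simp add: o_def)

lemma continuous_map_Div_r:
  assumes "continuous_map X T f" "continuous_map X T g"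
  shows "continuous_map X T (\<lambda>x. Div_r G (f x) (g x))"
  using continuous_map_compose[OF continuous_map_pairedI[OF assms] continuous_Div_r]
  by (simp add: o_def)

lemma continuous_map_constant: "a \<in> carrier G \<Longrightarrow> continuous_map X T (\<lambda>_. a)"
  by (simp add: topspace_eq)

lemmas continuous_maps = continuous_map_mult continuous_map_Div_l continuous_map_Div_r
  continuous_map_constant continuous_map_id[unfolded id_def]

text \<open>
  A $T_1$ topological loop is Hausdorff: two elements agree iff their quotient is the unit, and the
  unit is a closed point.
\<close>

lemma closedin_equalizer:
  assumes "t1_space T" and f: "continuous_map X T f" and g: "continuous_map X T g"
  shows "closedin X {x \<in> topspace X. f x = g x}"
proof -
  have "closedin T {\<one>}" by (rule closedin_t1_singleton[OF assms(1)]) (simp add: topspace_eq)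
  then have "closedin X {x \<in> topspace X. Div_l G (f x) (g x) \<in> {\<one>}}"
    by (rule closedin_continuous_map_preimage[OF continuous_map_Div_l[OF f g]])
  moreover have "Div_l G (f x) (g x) \<in> {\<one>} \<longleftrightarrow> f x = g x" if "x \<in> topspace X" for x
  proof -
    have fg: "f x \<in> carrier G" "g x \<in> carrier G"
      using continuous_map_image_subset_topspace[OF f] continuous_map_image_subset_topspace[OF g] that
      by (auto simp: topspace_eq)
    show ?thesis using Div_l[OF fg] Div_l_mult[OF fg(1) one_closed] fg by auto
  qed
  ultimately show ?thesis by (simp cong: conj_cong)
qed

lemma nucleus_closed:
  assumes "t1_space T"
  shows "closedin T (nucleus G)"
proof -
  have "closedin T (\<Inter>b\<in>carrier G. \<Inter>c\<in>carrier G.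
      {a \<in> topspace T. (a \<otimes> b) \<otimes> c = a \<otimes> (b \<otimes> c)} \<inter>
      {a \<in> topspace T. (b \<otimes> a) \<otimes> c = b \<otimes> (a \<otimes> c)} \<inter>
      {a \<in> topspace T. (b \<otimes> c) \<otimes> a = b \<otimes> (c \<otimes> a)})" (is "closedin T ?N")
    by (intro closedin_INT closedin_Int closedin_equalizer[OF assms] continuous_maps) auto
  also have "?N = nucleus G"
    using one_closed
    by (fastforce simp: nucleus_def left_nucleus_def middle_nucleus_def right_nucleus_def topspace_eq)
  finally show ?thesis .
qed

lemma stable_part_closed:
  assumes "associator_subgroup G H" and H: "closedin T H"
  shows "closedin T (associator_subgroup.stable_part G H)"
proof -
  interpret associator_subgroup G H by (rule assms(1))
  have "closedin T (H \<inter> (\<Inter>x\<in>carrier G.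
      {a \<in> topspace T. Div_r G x (x \<otimes> a) \<in> H} \<inter> {a \<in> topspace T. Div_l G x (a \<otimes> x) \<in> H}))"
    by (intro closedin_Int closedin_INT H closedin_continuous_map_preimage[OF _ H] continuous_maps)
      auto
  also have "\<dots> = stable_part" by (auto simp: stable_part_Div topspace_eq)
  finally show ?thesis .
qed

end

sublocale topological_fan_quasigroup \<subseteq> topological_unital_quasigroup ..

context topological_fan_quasigroup
begin

lemma fan_associator_subgroup:
  assumes "t1_space T"
  shows "associator_subgroup G (fan G T)" "closedin T (fan G T)"
proof -
  note least = fan_least[OF nucleus_subgroup nucleus_closed[OF assms]
      conjI[OF t_assoc_nucleus p_assoc_nucleus]]
  show "associator_subgroup G (fan G T)"
    by unfold_locales (use least in auto)
  show "closedin T (fan G T)" by (rule least(2))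
qed

text \<open>
  The stable part of the fan is a closed subgroup that contains all associators, so by minimality it
  is the whole fan.
\<close>

lemma fan_coset_commute:
  assumes "t1_space T" "x \<in> carrier G"
  shows "x <# fan G T = fan G T #> x"
proof -
  interpret N: associator_subgroup G "fan G T" by (rule fan_associator_subgroup[OF assms(1)])
  have "fan G T \<subseteq> N.stable_part"
    by (rule fan_least(3)[OF N.stable_part_subgroup stable_part_closed])
      (use fan_associator_subgroup[OF assms(1)] N.associators_stable in auto)
  then show ?thesis by (rule N.coset_commute_of_stable[OF _ assms(2)])
qed

end

section \<open>The quotient group\<close>

locale normal_associator_subgroup = associator_subgroup +
  assumes coset_commute: "x \<in> carrier G \<Longrightarrow> x <# H = H #> x"
begin

lemma commute_past:
  assumes "h \<in> H" "x \<in> carrier G"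
  obtains k where "k \<in> H" "h \<otimes> x = x \<otimes> k"
  using coset_commute[OF assms(2)] assms(1) l_coset_iff[of "h \<otimes> x" x] r_coset_iff[of "h \<otimes> x" x]
  by blast

lemma l_coset_mult:
  assumes "h \<in> H" "x \<in> carrier G"
  shows "(x \<otimes> h) <# H = x <# H"
proof
  obtain k where k: "k \<in> H" "h \<otimes> k = \<one>" by (rule H_inverse[OF assms(1)])
  show "(x \<otimes> h) <# H \<subseteq> x <# H"
  proof
    fix y assume "y \<in> (x \<otimes> h) <# H"
    then obtain l where "l \<in> H" "y = (x \<otimes> h) \<otimes> l" unfolding l_coset_iff by blast
    then have "h \<otimes> l \<in> H" "y = x \<otimes> (h \<otimes> l)" using assms by (simp_all add: H_assoc(2))
    then show "y \<in> x <# H" unfolding l_coset_iff by blast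
  qed
  show "x <# H \<subseteq> (x \<otimes> h) <# H"
  proof
    fix y assume "y \<in> x <# H"
    then obtain l where l: "l \<in> H" "y = x \<otimes> l" unfolding l_coset_iff by blast
    have "h \<otimes> (k \<otimes> l) = l" using H_assoc(1)[of h k l] assms k l(1) by simp
    then have "y = (x \<otimes> h) \<otimes> (k \<otimes> l)" using assms k(1) l by (simp add: H_assoc(2))
    moreover have "k \<otimes> l \<in> H" using k(1) l(1) by simp
    ultimately show "y \<in> (x \<otimes> h) <# H" unfolding l_coset_iff by blast
  qed
qed

lemma mem_own_l_coset: "x \<in> carrier G \<Longrightarrow> x \<in> x <# H"
  unfolding l_coset_iff by (intro bexI[of _ \<one>]) simp_all

lemma l_coset_eq_iff:
  assumes "x \<in> carrier G" "y \<in> carrier G"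
  shows "x <# H = y <# H \<longleftrightarrow> (\<exists>h\<in>H. y = x \<otimes> h)"
  using mem_own_l_coset[OF assms(2)] l_coset_mult[OF _ assms(1)] l_coset_iff[of y x] by metis

text \<open>
  Independence of the representatives: $(ah)(bk) = ((ah)b)k = (a(bl))k = ((ab)l)k$, where
  $hb = bl$ by the normality of \<open>H\<close> and the rebracketings are due to $h, k, l$ being nuclear.
\<close>

lemma coset_mult_eq:
  assumes a: "a \<in> carrier G" and b: "b \<in> carrier G"
  shows "coset_mult G H (a <# H) (b <# H) = (a \<otimes> b) <# H"
  unfolding coset_mult_def
proof (rule the_equality)
  fix C assume "\<exists>a'\<in>carrier G. \<exists>b'\<in>carrier G.
    a <# H = a' <# H \<and> b <# H = b' <# H \<and> C = (a' \<otimes> b') <# H"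
  then obtain a' b' where a': "a' \<in> carrier G" "a <# H = a' <# H"
    and b': "b' \<in> carrier G" "b <# H = b' <# H" and C: "C = (a' \<otimes> b') <# H" by blast
  obtain h where h: "h \<in> H" "a' = a \<otimes> h" using a' a by (auto simp: l_coset_eq_iff)
  obtain k where k: "k \<in> H" "b' = b \<otimes> k" using b' b by (auto simp: l_coset_eq_iff)
  obtain l where l: "l \<in> H" "h \<otimes> b = b \<otimes> l" by (rule commute_past[OF h(1) b])
  have "a' \<otimes> b' = ((a \<otimes> h) \<otimes> b) \<otimes> k"
    unfolding h(2) k(2) using a b h(1) k(1) by (intro H_assoc(3)[symmetric]) auto
  also have "(a \<otimes> h) \<otimes> b = (a \<otimes> b) \<otimes> l"
    using H_assoc(2)[OF h(1) a b] H_assoc(3)[OF l(1) a b] l(2) by simp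
  finally have "a' \<otimes> b' = ((a \<otimes> b) \<otimes> l) \<otimes> k" .
  then show "C = (a \<otimes> b) <# H" using C a b l(1) k(1) by (simp add: l_coset_mult)
qed (use a b in blast)

abbreviation Q :: "'a set monoid" where "Q \<equiv> coset_quotient G H"

lemma carrier_Q: "carrier Q = (\<lambda>b. b <# H) ` carrier G"
  by (simp add: coset_quotient_def)

lemma mult_Q:
  "\<lbrakk>a \<in> carrier G; b \<in> carrier G\<rbrakk> \<Longrightarrow> (a <# H) \<otimes>\<^bsub>Q\<^esub> (b <# H) = (a \<otimes> b) <# H"
  by (simp add: coset_quotient_def coset_mult_eq)

lemma one_Q: "\<one>\<^bsub>Q\<^esub> = \<one> <# H"
  by (simp add: coset_quotient_def)

text \<open>
  The two bracketings differ by a right factor from \<open>H\<close>, which the coset absorbs.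
\<close>

lemma coset_assoc:
  assumes "a \<in> carrier G" "b \<in> carrier G" "c \<in> carrier G"
  shows "((a \<otimes> b) \<otimes> c) <# H = (a \<otimes> (b \<otimes> c)) <# H"
  using p_assoc[OF assms] l_coset_mult[OF p_assoc_mem[OF assms]] assms by simp

lemma group_Q: "group Q"
proof (rule groupI)
  fix A assume "A \<in> carrier Q"
  then obtain a where a: "a \<in> carrier G" "A = a <# H" by (auto simp: carrier_Q)
  show "\<one>\<^bsub>Q\<^esub> \<otimes>\<^bsub>Q\<^esub> A = A" using a by (simp add: one_Q mult_Q)
  show "\<exists>B\<in>carrier Q. B \<otimes>\<^bsub>Q\<^esub> A = \<one>\<^bsub>Q\<^esub>"
    using a Div_r[OF a(1) one_closed]
    by (intro bexI[of _ "Div_r G a \<one> <# H"]) (auto simp: carrier_Q one_Q mult_Q)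
qed (auto simp: carrier_Q one_Q mult_Q coset_assoc)

lemma inv_Q:
  assumes "a \<in> carrier G"
  shows "inv\<^bsub>Q\<^esub> (a <# H) = Div_l G a \<one> <# H"
proof -
  interpret Q: group Q by (rule group_Q)
  have "(a <# H) \<otimes>\<^bsub>Q\<^esub> (Div_l G a \<one> <# H) = \<one>\<^bsub>Q\<^esub>"
    using assms Div_l[OF assms one_closed] by (simp add: mult_Q one_Q)
  then show ?thesis
    using assms Div_l[OF assms one_closed]
    by (metis Q.inv_equality Q.inv_inv Q.inv_closed carrier_Q imageI)
qed

end

section \<open>The topology of the quotient\<close>

locale topological_normal_associator_subgroup =
  topological_unital_quasigroup G T + normal_associator_subgroup G H
  for G (structure) and T H +
  assumes H_closed: "closedin T H"
begin

abbreviation TQ :: "'a set topology" where "TQ \<equiv> coset_topology G T H"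

lemma topspace_TQ: "topspace TQ = carrier Q"
  by (simp add: coset_topology_def carrier_Q topspace_eq)

lemma quotient_map_l_coset: "quotient_map T TQ (\<lambda>b. b <# H)"
  unfolding coset_topology_def by (rule quotient_map_quotient_topology)

lemma openin_mult_right:
  assumes U: "openin T U" and h: "h \<in> carrier G"
  shows "openin T ((\<lambda>u. u \<otimes> h) ` U)"
proof -
  have UG: "U \<subseteq> carrier G" using openin_subset[OF U] by (simp add: topspace_eq)
  have "openin T {x \<in> topspace T. Div_r G h x \<in> U}"
    using h by (intro openin_continuous_map_preimage[OF _ U] continuous_maps)
  also have "{x \<in> topspace T. Div_r G h x \<in> U} = (\<lambda>u. u \<otimes> h) ` U"
  proof (intro subset_antisym subsetI)
    fix x assume "x \<in> {x \<in> topspace T. Div_r G h x \<in> U}"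
    then show "x \<in> (\<lambda>u. u \<otimes> h) ` U"
      using Div_r(2)[OF h, of x] by (intro image_eqI[of _ _ "Div_r G h x"]) (auto simp: topspace_eq)
  next
    fix x assume "x \<in> (\<lambda>u. u \<otimes> h) ` U"
    then show "x \<in> {x \<in> topspace T. Div_r G h x \<in> U}"
      using UG h by (auto simp: topspace_eq Div_r_mult)
  qed
  finally show ?thesis .
qed

text \<open>
  The saturation of an open set \<open>U\<close> is the union of its right translates $Uh$ for $h \in H$, and right
  translations are homeomorphisms.
\<close>

lemma open_map_l_coset: "open_map T TQ (\<lambda>b. b <# H)"
  unfolding open_map_def
proof (intro allI impI)
  fix U assume U: "openin T U"
  have UG: "U \<subseteq> carrier G" using openin_subset[OF U] by (simp add: topspace_eq)
  have "openin T (\<Union>h\<in>H. (\<lambda>u. u \<otimes> h) ` U)"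
    by (intro openin_Union) (use U openin_mult_right in auto)
  also have "(\<Union>h\<in>H. (\<lambda>u. u \<otimes> h) ` U) = {x \<in> topspace T. x <# H \<in> (\<lambda>b. b <# H) ` U}"
  proof (intro subset_antisym subsetI)
    fix x assume "x \<in> (\<Union>h\<in>H. (\<lambda>u. u \<otimes> h) ` U)"
    then show "x \<in> {x \<in> topspace T. x <# H \<in> (\<lambda>b. b <# H) ` U}"
      using UG by (auto simp: topspace_eq l_coset_mult subset_iff)
  next
    fix x assume "x \<in> {x \<in> topspace T. x <# H \<in> (\<lambda>b. b <# H) ` U}"
    then obtain u where u: "u \<in> U" "x \<in> carrier G" "u <# H = x <# H" by (auto simp: topspace_eq)
    moreover have "u \<in> carrier G" using u(1) UG by blast
    ultimately obtain h where "h \<in> H" "x = u \<otimes> h" by (auto simp: l_coset_eq_iff)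
    with u(1) show "x \<in> (\<Union>h\<in>H. (\<lambda>u. u \<otimes> h) ` U)" by blast
  qed
  finally show "openin TQ ((\<lambda>b. b <# H) ` U)"
    unfolding coset_topology_def openin_quotient_topology
    using UG by (auto simp: topspace_eq)
qed

text \<open>
  A product of quotient maps need not be a quotient map. The projection is open, however, so an open
  box around a pair of representatives is carried to an open box around the pair of cosets.
\<close>

lemma continuous_mult_Q: "continuous_map (prod_topology TQ TQ) TQ (\<lambda>(A, B). A \<otimes>\<^bsub>Q\<^esub> B)"
  unfolding continuous_map_def
proof (intro conjI allI impI)
  interpret Q: group Q by (rule group_Q)
  show "(\<lambda>(A, B). A \<otimes>\<^bsub>Q\<^esub> B) \<in> topspace (prod_topology TQ TQ) \<rightarrow> topspace TQ"
    by (auto simp: topspace_TQ)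
  fix W assume W: "openin TQ W"
  have cont: "continuous_map (prod_topology T T) TQ ((\<lambda>b. b <# H) \<circ> (\<lambda>(a, b). a \<otimes> b))"
    by (rule continuous_map_compose[OF continuous_mult
          quotient_imp_continuous_map[OF quotient_map_l_coset]])
  let ?P = "{p \<in> topspace (prod_topology T T). ((\<lambda>b. b <# H) \<circ> (\<lambda>(a, b). a \<otimes> b)) p \<in> W}"
  have P: "openin (prod_topology T T) ?P" by (rule openin_continuous_map_preimage[OF cont W])
  show "openin (prod_topology TQ TQ)
      {p \<in> topspace (prod_topology TQ TQ). (case p of (A, B) \<Rightarrow> A \<otimes>\<^bsub>Q\<^esub> B) \<in> W}" (is "openin _ ?R")
    unfolding openin_prod_topology_alt
  proof (intro allI impI)
    fix A B assume AB: "(A, B) \<in> ?R"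
    then obtain a b where ab: "a \<in> carrier G" "b \<in> carrier G" "A = a <# H" "B = b <# H"
      by (auto simp: topspace_TQ carrier_Q)
    have mem: "(a, b) \<in> ?P" using AB ab by (simp add: topspace_eq mult_Q)
    obtain U V where UV: "openin T U" "openin T V" "a \<in> U" "b \<in> V" "U \<times> V \<subseteq> ?P"
      using P[unfolded openin_prod_topology_alt, rule_format, OF mem] by (elim exE conjE)
    have "(u <# H, v <# H) \<in> ?R" if "u \<in> U" "v \<in> V" for u v
    proof -
      have "(u, v) \<in> ?P" using UV(5) that by blast
      then show ?thesis by (auto simp: topspace_eq topspace_TQ carrier_Q mult_Q)
    qed
    then have "(\<lambda>b. b <# H) ` U \<times> (\<lambda>b. b <# H) ` V \<subseteq> ?R" by blast
    moreover have "openin TQ ((\<lambda>b. b <# H) ` U)" "openin TQ ((\<lambda>b. b <# H) ` V)"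
      using open_map_l_coset UV(1,2) by (auto simp: open_map_def)
    moreover have "A \<in> (\<lambda>b. b <# H) ` U" "B \<in> (\<lambda>b. b <# H) ` V" using ab UV(3,4) by auto
    ultimately show "\<exists>U V. openin TQ U \<and> openin TQ V \<and> A \<in> U \<and> B \<in> V \<and> U \<times> V \<subseteq> ?R"
      by (intro exI conjI)
  qed
qed

lemma continuous_inv_Q: "continuous_map TQ TQ (m_inv Q)"
proof (rule continuous_compose_quotient_map[OF quotient_map_l_coset])
  have "continuous_map T TQ ((\<lambda>b. b <# H) \<circ> (\<lambda>a. Div_l G a \<one>))"
    by (intro continuous_map_compose[OF _ quotient_imp_continuous_map[OF quotient_map_l_coset]]
        continuous_maps) simp
  then show "continuous_map T TQ (m_inv Q \<circ> (\<lambda>b. b <# H))"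
    by (rule continuous_map_eq) (simp add: topspace_eq inv_Q)
qed

lemma topological_group_Q: "topological_group Q TQ"
  by (intro topological_group.intro topological_group_axioms.intro group_Q topspace_TQ
      continuous_mult_Q continuous_inv_Q)

text \<open>
  A coset $aH$ is the preimage of the closed set \<open>H\<close> under $x \mapsto a\backslash x$.
\<close>

lemma t1_TQ: "t1_space TQ"
  unfolding t1_space_closedin_singleton
proof
  fix A assume A: "A \<in> topspace TQ"
  then obtain a where a: "a \<in> carrier G" "A = a <# H" by (auto simp: topspace_TQ carrier_Q)
  have "closedin T {x \<in> topspace T. Div_l G a x \<in> H}"
    using a by (intro closedin_continuous_map_preimage[OF _ H_closed] continuous_maps)
  also have "{x \<in> topspace T. Div_l G a x \<in> H} = {x \<in> topspace T. x <# H \<in> {A}}"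
  proof -
    have "Div_l G a x \<in> H \<longleftrightarrow> a <# H = x <# H" if x: "x \<in> carrier G" for x
      unfolding l_coset_eq_iff[OF a(1) x]
      using Div_l[OF a(1) x] Div_l_mult[OF a(1)] by (metis H_carrier)
    then show ?thesis using a(2) by (auto simp: topspace_eq)
  qed
  finally have "closedin T {x \<in> topspace T. x <# H \<in> {A}}" .
  moreover have "\<forall>U. U \<subseteq> topspace TQ \<longrightarrow>
      (closedin T {x \<in> topspace T. x <# H \<in> U} \<longleftrightarrow> closedin TQ U)"
    using quotient_map_l_coset by (simp add: quotient_map_closedin)
  ultimately show "closedin TQ {A}" using A by blast
qed

end

section \<open>Fans and quotients of topological fan quasigroups\<close>

theorem theorem4:
  fixes G :: "('a, 'b) monoid_scheme" and T :: "'a topology"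
  assumes "topological_fan_quasigroup G T" and "t1_space T"
  shows "subgroup_in (fan G T) G \<and> normal_subquasigroup (fan G T) G \<and>
    (\<forall>N1. subgroup_in N1 G \<and> closedin T N1 \<and> fan G T \<subseteq> N1 \<and> N1 \<subseteq> nucleus G \<and>
       (\<forall>x\<in>carrier G. x <#\<^bsub>G\<^esub> N1 = N1 #>\<^bsub>G\<^esub> x) \<longrightarrow>
       (\<forall>a\<in>carrier G. \<forall>b\<in>carrier G.
          (a <#\<^bsub>G\<^esub> N1) \<otimes>\<^bsub>coset_quotient G N1\<^esub> (b <#\<^bsub>G\<^esub> N1) = (a \<otimes>\<^bsub>G\<^esub> b) <#\<^bsub>G\<^esub> N1) \<and>
       topological_group (coset_quotient G N1) (coset_topology G T N1) \<and>
       t1_space (coset_topology G T N1) \<and>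
       completely_regular_space (coset_topology G T N1))"
proof -
  interpret topological_fan_quasigroup G T by (rule assms(1))
  interpret N0: associator_subgroup G "fan G T" by (rule fan_associator_subgroup[OF assms(2)])
  have "normal_subquasigroup (fan G T) G"
    by (rule N0.normal_subquasigroupI[OF fan_coset_commute[OF assms(2)]])
  moreover have "(\<forall>a\<in>carrier G. \<forall>b\<in>carrier G.
        (a <#\<^bsub>G\<^esub> N1) \<otimes>\<^bsub>coset_quotient G N1\<^esub> (b <#\<^bsub>G\<^esub> N1) = (a \<otimes>\<^bsub>G\<^esub> b) <#\<^bsub>G\<^esub> N1) \<and>
      topological_group (coset_quotient G N1) (coset_topology G T N1) \<and>
      t1_space (coset_topology G T N1) \<and> completely_regular_space (coset_topology G T N1)"
    if N1: "subgroup_in N1 G" "closedin T N1" "fan G T \<subseteq> N1" "N1 \<subseteq> nucleus G"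
      "\<forall>x\<in>carrier G. x <#\<^bsub>G\<^esub> N1 = N1 #>\<^bsub>G\<^esub> x" for N1
  proof -
    interpret N1: topological_normal_associator_subgroup G T N1
      by unfold_locales (use N1 N0.t_assoc_mem N0.p_assoc_mem in auto)
    show ?thesis
      using N1.mult_Q N1.topological_group_Q N1.t1_TQ
        topological_group.completely_regular[OF N1.topological_group_Q] by blast
  qed
  ultimately show ?thesis using N0.is_subgroup by blast
qed

end
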